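(* Let $(S,A,r,P,\mu_0,H)$ be a finite-horizon mean-field game satisfying Assumptions 1 (weak monotonicity), 2 (transition kernel independent of the state measure) and 3 (Lipschitz reward) stated in the context. Let $\pi^*=(\pi^*_h)_{h=0}^{H-1}$ be a policy flow and $\mu^*=(\mu^*_h)_{h=0}^{H-1}$ a state-measure flow (with $\mu^*_0=\mu_0$), and define $\rho^*_h(s,a)=\pi^*_h(a\mid s)\,\mu^*_h(s)$ for $h=0,\dots,H-1$, $(s,a)\in S\times A$. Then $(\pi^*,\mu^* )$ is a mean-field equilibrium if and only if $\rho^*\in\mathcal K$ and $$\langle F(\rho^* ),\,\rho-\rho^*\rangle\ge 0\qquad\text{for all }\rho\in\mathcal K.$$
   Context: Mean-field game: $S$ and $A$ are finite nonempty sets, $H\ge 1$ an integer, $\mathcal P(S)$ the set of probability measures on $S$, $\mu_0\in\mathcal P(S)$, $r:S\times A\times\mathcal P(S)\to\mathbb R$ the reward, $P:S\times A\times\mathcal P(S)\to\mathcal P(S)$ the transition kernel. A policy flow is $\pi=(\pi_h)_{h=0}^{H-1}$ with $\pi_h(\cdot\mid s)\in\mathcal P(A)$ for each $s\in S$. A state-measure flow is $\mu=(\mu_h)_{h=0}^{H-1}$ with $\mu_h\in\mathcal P(S)$, whose first entry is always the given $\mu_0$. Objective: $J(\pi,\mu)=\mathbb E\big[\sum_{h=0}^{H-1} r(x_h,a_h,\mu_h)\big]$, where $x_0\sim\mu_0$, $a_h\sim\pi_h(\cdot\mid x_h)$, $x_{h+1}\sim P(\cdot\mid x_h,a_h,\mu_h)$.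 A pair $(\pi^*,\mu^* )$ is a mean-field equilibrium (MFE) if $J(\pi,\mu^* )\le J(\pi^*,\mu^* )$ for every policy flow $\pi$, and $\mu^*_{h+1}(\cdot)=\sum_{s\in S}\sum_{a\in A}P(\cdot\mid s,a,\mu^*_h)\pi^*_h(a\mid s)\mu^*_h(s)$ for $h=0,\dots,H-2$. Assumption 2: $P(\cdot\mid s,a,\mu)=P(\cdot\mid s,a)$ for all $\mu\in\mathcal P(S)$. Given a policy flow $\pi$, its state flow is $\mu^\pi_0=\mu_0$, $\mu^\pi_{h+1}(s')=\sum_{s,a}P(s'\mid s,a)\pi_h(a\mid s)\mu^\pi_h(s)$, and its occupation flow is $\rho^\pi_h(s,a)=\pi_h(a\mid s)\mu^\pi_h(s)$. Assumption 1 (weak monotonicity): for all policy flows $\pi,\tilde\pi$, $\sum_{h=0}^{H-1}\sum_{s,a}\big(r(s,a,\mu^\pi_h)-r(s,a,\mu^{\tilde\pi}_h)\big)\big(\rho^\pi_h(s,a)-\rho^{\tilde\pi}_h(s,a)\big)\le 0$. Assumption 3: $|r(s,a,\mu)-r(s,a,\tilde\mu)|\le L_r\|\mu-\tilde\mu\|_{\mathrm{TV}}$ for all $(s,a)$ and $\mu,\tilde\mu\in\mathcal P(S)$, where $\|\mu-\tilde\mu\|_{\mathrm{TV}}=\sum_{s}|\mu(s)-\tilde\mu(s)|$. Occupation-flow polytope: $\mathcal K$ is the set of $\rho=(\rho_h)_{h=0}^{H-1}\in\prod_{h=0}^{H-1}\mathbb R_+^{S\times A}$ with $\sum_a\rho_0(s,a)=\mu_0(s)$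 for all $s$, and $\sum_a\rho_{h+1}(s',a)=\sum_{s,a}P(s'\mid s,a)\rho_h(s,a)$ for all $s'\in S$, $h=0,\dots,H-2$. For $\rho\in\mathcal K$ put $\mu^\rho_h(s)=\sum_a\rho_h(s,a)$. The mean-field occupation operator $F:\mathcal K\to\mathbb R^{H|S||A|}$ is $[F(\rho)]_{h,s,a}=-r(s,a,\mu^\rho_h)$. $\langle\cdot,\cdot\rangle$ is the Euclidean inner product. *)

theory Defs
  imports "HOL-Probability.Probability_Mass_Function"
begin

text \<open>
  The finite nonempty sets of states and actions are the types \<^typ>\<open>'s::finite\<close> and
  \<^typ>\<open>'a::finite\<close>; \<^typ>\<open>'s pmf\<close> is then the set of all probability measures
  on the states.  A flow over the horizon is a function on \<^typ>\<open>nat\<close>, and only its values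
  at stages below \<open>H\<close> are ever constrained or used.
\<close>

type_synonym ('s, 'a) reward = "'s \<Rightarrow> 'a \<Rightarrow> 's pmf \<Rightarrow> real"
type_synonym ('s, 'a) mf_kernel = "'s \<Rightarrow> 'a \<Rightarrow> 's pmf \<Rightarrow> 's pmf"
type_synonym ('s, 'a) policy_flow = "nat \<Rightarrow> 's \<Rightarrow> 'a pmf"
type_synonym 's state_flow = "nat \<Rightarrow> 's pmf"
type_synonym ('s, 'a) real_flow = "nat \<Rightarrow> 's \<Rightarrow> 'a \<Rightarrow> real"

text \<open>
  \<open>path_pmf P \<pi> \<mu> n h x\<close> is the law of the \<open>n\<close> state-action pairs visited
  at the stages \<open>h, \<dots>, h + n - 1\<close> when the state at stage \<open>h\<close> is \<open>x\<close>.
\<close>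

primrec path_pmf ::
  "('s, 'a) mf_kernel \<Rightarrow> ('s, 'a) policy_flow \<Rightarrow> 's state_flow \<Rightarrow>
   nat \<Rightarrow> nat \<Rightarrow> 's \<Rightarrow> ('s \<times> 'a) list pmf" where
  "path_pmf P \<pi> \<mu> 0 h x = return_pmf []"
| "path_pmf P \<pi> \<mu> (Suc n) h x =
     do {
       a \<leftarrow> \<pi> h x;
       y \<leftarrow> P x a (\<mu> h);
       \<omega> \<leftarrow> path_pmf P \<pi> \<mu> n (Suc h) y;
       return_pmf ((x, a) # \<omega>)
     }"

definition trajectory_pmf ::
  "nat \<Rightarrow> 's pmf \<Rightarrow> ('s, 'a) mf_kernel \<Rightarrow> ('s, 'a) policy_flow \<Rightarrow> 's state_flow \<Rightarrow>
   ('s \<times> 'a) list pmf" where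
  "trajectory_pmf H \<mu>\<^sub>0 P \<pi> \<mu> = do { x \<leftarrow> \<mu>\<^sub>0; path_pmf P \<pi> \<mu> H 0 x }"

definition objective ::
  "nat \<Rightarrow> 's pmf \<Rightarrow> ('s, 'a) reward \<Rightarrow> ('s, 'a) mf_kernel \<Rightarrow>
   ('s, 'a) policy_flow \<Rightarrow> 's state_flow \<Rightarrow> real" where
  "objective H \<mu>\<^sub>0 r P \<pi> \<mu> =
     measure_pmf.expectation (trajectory_pmf H \<mu>\<^sub>0 P \<pi> \<mu>)
       (\<lambda>\<omega>. \<Sum>h<H. r (fst (\<omega> ! h)) (snd (\<omega> ! h)) (\<mu> h))"

definition mean_field_equilibrium ::
  "nat \<Rightarrow> 's::finite pmf \<Rightarrow> ('s, 'a::finite) reward \<Rightarrow> ('s, 'a) mf_kernel \<Rightarrow>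
   ('s, 'a) policy_flow \<Rightarrow> 's state_flow \<Rightarrow> bool" where
  "mean_field_equilibrium H \<mu>\<^sub>0 r P \<pi>' \<mu>' \<longleftrightarrow>
     (\<forall>\<pi>. objective H \<mu>\<^sub>0 r P \<pi> \<mu>' \<le> objective H \<mu>\<^sub>0 r P \<pi>' \<mu>') \<and>
     (\<forall>h. Suc h < H \<longrightarrow> (\<forall>s'.
        pmf (\<mu>' (Suc h)) s' =
          (\<Sum>s\<in>UNIV. \<Sum>a\<in>UNIV. pmf (P s a (\<mu>' h)) s' * pmf (\<pi>' h s) a * pmf (\<mu>' h) s)))"

definition occupation :: "('s, 'a) policy_flow \<Rightarrow> 's state_flow \<Rightarrow> ('s, 'a) real_flow" where
  "occupation \<pi> \<mu> h s a = pmf (\<pi> h s) a * pmf (\<mu> h) s"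

text \<open>
  In what follows \<open>Q\<close> is a transition kernel that does not depend on the state measure.
\<close>

primrec induced_flow ::
  "'s pmf \<Rightarrow> ('s \<Rightarrow> 'a \<Rightarrow> 's pmf) \<Rightarrow> ('s, 'a) policy_flow \<Rightarrow> 's state_flow" where
  "induced_flow \<mu>\<^sub>0 Q \<pi> 0 = \<mu>\<^sub>0"
| "induced_flow \<mu>\<^sub>0 Q \<pi> (Suc h) =
     do { s \<leftarrow> induced_flow \<mu>\<^sub>0 Q \<pi> h; a \<leftarrow> \<pi> h s; Q s a }"

lemma pmf_induced_flow_Suc:
  fixes Q :: "'s::finite \<Rightarrow> 'a::finite \<Rightarrow> 's pmf"
  shows "pmf (induced_flow \<mu>\<^sub>0 Q \<pi> (Suc h)) s' =
    (\<Sum>s\<in>UNIV. \<Sum>a\<in>UNIV. pmf (Q s a) s' * pmf (\<pi> h s) a * pmf (induced_flow \<mu>\<^sub>0 Q \<pi> h) s)"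
  by (simp add: pmf_bind integral_measure_pmf_real[where A = UNIV] sum_distrib_right)

definition weakly_monotone ::
  "nat \<Rightarrow> 's::finite pmf \<Rightarrow> ('s, 'a::finite) reward \<Rightarrow> ('s \<Rightarrow> 'a \<Rightarrow> 's pmf) \<Rightarrow> bool" where
  "weakly_monotone H \<mu>\<^sub>0 r Q \<longleftrightarrow>
     (\<forall>\<pi> \<pi>'.
        let \<mu> = induced_flow \<mu>\<^sub>0 Q \<pi>; \<mu>' = induced_flow \<mu>\<^sub>0 Q \<pi>' in
        (\<Sum>h<H. \<Sum>s\<in>UNIV. \<Sum>a\<in>UNIV.
           (r s a (\<mu> h) - r s a (\<mu>' h)) * (occupation \<pi> \<mu> h s a - occupation \<pi>' \<mu>' h s a)) \<le> 0)"

text \<open>The total variation norm is taken without the factor \<open>1/2\<close>.\<close>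

definition tv_dist :: "'s::finite pmf \<Rightarrow> 's pmf \<Rightarrow> real" where
  "tv_dist \<mu> \<nu> = (\<Sum>s\<in>UNIV. \<bar>pmf \<mu> s - pmf \<nu> s\<bar>)"

definition lipschitz_reward :: "('s::finite, 'a) reward \<Rightarrow> real \<Rightarrow> bool" where
  "lipschitz_reward r L \<longleftrightarrow> (\<forall>s a \<mu> \<nu>. \<bar>r s a \<mu> - r s a \<nu>\<bar> \<le> L * tv_dist \<mu> \<nu>)"

definition occupation_polytope ::
  "nat \<Rightarrow> 's::finite pmf \<Rightarrow> ('s \<Rightarrow> 'a::finite \<Rightarrow> 's pmf) \<Rightarrow> ('s, 'a) real_flow set" where
  "occupation_polytope H \<mu>\<^sub>0 Q =
     {\<rho>. (\<forall>h<H. \<forall>s a. 0 \<le> \<rho> h s a) \<and>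
          (\<forall>s. (\<Sum>a\<in>UNIV. \<rho> 0 s a) = pmf \<mu>\<^sub>0 s) \<and>
          (\<forall>h. Suc h < H \<longrightarrow> (\<forall>s'.
             (\<Sum>a\<in>UNIV. \<rho> (Suc h) s' a) = (\<Sum>s\<in>UNIV. \<Sum>a\<in>UNIV. pmf (Q s a) s' * \<rho> h s a)))}"

text \<open>
  \<^const>\<open>embed_pmf\<close> is meaningful only when the marginal is a probability vector; the lemma
  below shows that this is so at every stage of an element of the polytope.
\<close>

definition state_marginal :: "('s, 'a::finite) real_flow \<Rightarrow> 's state_flow" where
  "state_marginal \<rho> h = embed_pmf (\<lambda>s. \<Sum>a\<in>UNIV. \<rho> h s a)"

lemma pmf_state_marginal:
  fixes Q :: "'s::finite \<Rightarrow> 'a::finite \<Rightarrow> 's pmf"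
  assumes \<rho>: "\<rho> \<in> occupation_polytope H \<mu>\<^sub>0 Q" and h: "h < H"
  shows "pmf (state_marginal \<rho> h) s = (\<Sum>a\<in>UNIV. \<rho> h s a)"
proof -
  have nonneg: "0 \<le> (\<Sum>a\<in>UNIV. \<rho> h s a)" for s
    using \<rho> h by (intro sum_nonneg) (simp add: occupation_polytope_def)
  have "(\<Sum>s\<in>UNIV. \<Sum>a\<in>UNIV. \<rho> h s a) = 1"
    using h
  proof (induction h)
    case 0
    then show ?case
      using \<rho> by (simp add: occupation_polytope_def sum_pmf_eq_1)
  next
    case (Suc h)
    have "(\<Sum>s'\<in>UNIV. \<Sum>a\<in>UNIV. \<rho> (Suc h) s' a) =
        (\<Sum>s'\<in>UNIV. \<Sum>s\<in>UNIV. \<Sum>a\<in>UNIV. pmf (Q s a) s' * \<rho> h s a)"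
      using \<rho> Suc.prems by (simp add: occupation_polytope_def)
    also have "\<dots> = (\<Sum>s\<in>UNIV. \<Sum>s'\<in>UNIV. \<Sum>a\<in>UNIV. pmf (Q s a) s' * \<rho> h s a)"
      by (rule sum.swap)
    also have "\<dots> = (\<Sum>s\<in>UNIV. \<Sum>a\<in>UNIV. \<Sum>s'\<in>UNIV. pmf (Q s a) s' * \<rho> h s a)"
      by (intro sum.cong refl sum.swap)
    also have "\<dots> = (\<Sum>s\<in>UNIV. \<Sum>a\<in>UNIV. \<rho> h s a)"
      by (simp add: sum_distrib_right[symmetric] sum_pmf_eq_1)
    finally show ?case
      using Suc by simp
  qed
  then have "(\<integral>\<^sup>+s. ennreal (\<Sum>a\<in>UNIV. \<rho> h s a) \<partial>count_space UNIV) = 1"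
    using nonneg by (simp add: nn_integral_count_space_finite)
  with nonneg show ?thesis
    unfolding state_marginal_def by (intro pmf_embed_pmf)
qed

definition occupation_operator ::
  "('s, 'a::finite) reward \<Rightarrow> ('s, 'a) real_flow \<Rightarrow> ('s, 'a) real_flow" where
  "occupation_operator r \<rho> h s a = - r s a (state_marginal \<rho> h)"

definition flow_inner ::
  "nat \<Rightarrow> ('s::finite, 'a::finite) real_flow \<Rightarrow> ('s, 'a) real_flow \<Rightarrow> real" where
  "flow_inner H x y = (\<Sum>h<H. \<Sum>s\<in>UNIV. \<Sum>a\<in>UNIV. x h s a * y h s a)"

end

theory Submission
  imports Defs
begin

text \<open>
  With the state measures frozen at \<open>\<mu>'\<close>, the objective is a linear function of the occupation
  flow induced by the policy.  The occupation flows of policies are exactly the points of the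
  polytope (disintegrate a point into its conditional distributions), so optimality of
  \<open>\<pi>'\<close> against \<open>\<mu>'\<close> is the variational inequality, while consistency of
  \<open>\<mu>'\<close> says that \<open>\<rho>'\<close> lies in the polytope.
\<close>

lemma finite_set_path_pmf:
  fixes P :: "('s::finite, 'a::finite) mf_kernel"
  shows "finite (set_pmf (path_pmf P \<pi> \<mu> n h x))"
  by (induction n arbitrary: h x) auto

text \<open>Policy evaluation by one-step recursion: condition on the first action and the next
  state. The stage reward \<open>g\<close> is arbitrary and is read at \<open>h + k\<close>, so that
  the tail of a path is again an instance, started at \<open>Suc h\<close>.\<close>

lemma expectation_path_pmf_Suc:
  fixes P :: "('s::finite, 'a::finite) mf_kernel" and g :: "nat \<Rightarrow> 's \<Rightarrow> 'a \<Rightarrow> real"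
    and \<pi> :: "('s, 'a) policy_flow" and \<mu> :: "'s state_flow"
  defines "V \<equiv> \<lambda>n h x. measure_pmf.expectation (path_pmf P \<pi> \<mu> n h x)
      (\<lambda>\<omega>. \<Sum>k<n. g (h + k) (fst (\<omega> ! k)) (snd (\<omega> ! k)))"
  shows "V (Suc n) h x =
    (\<Sum>a\<in>UNIV. pmf (\<pi> h x) a * (g h x a + (\<Sum>y\<in>UNIV. pmf (P x a (\<mu> h)) y * V n (Suc h) y)))"
proof -
  \<comment> \<open>Prepending \<open>(x, a)\<close> moves every later pair up by one index, and
    \<open>h + Suc k = Suc h + k\<close>.\<close>
  have tail: "measure_pmf.expectation
        (path_pmf P \<pi> \<mu> n (Suc h) y \<bind> (\<lambda>\<omega>. return_pmf ((x, a) # \<omega>)))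
        (\<lambda>\<omega>. \<Sum>k<Suc n. g (h + k) (fst (\<omega> ! k)) (snd (\<omega> ! k))) = g h x a + V n (Suc h) y" for a y
    by (simp add: map_pmf_def[symmetric] sum.lessThan_Suc_shift V_def
        integrable_measure_pmf_finite finite_set_path_pmf del: sum.lessThan_Suc)
  have "V (Suc n) h x = (\<Sum>a\<in>UNIV. pmf (\<pi> h x) a *
      (\<Sum>y\<in>UNIV. pmf (P x a (\<mu> h)) y * (g h x a + V n (Suc h) y)))"
    unfolding V_def path_pmf.simps
    by (subst pmf_expectation_bind[where A = UNIV];
        simp add: finite_set_path_pmf pmf_expectation_bind[where A = UNIV] tail[unfolded V_def]
          del: sum.lessThan_Suc)
  then show ?thesis
    by (simp add: distrib_left sum.distrib sum_distrib_right[symmetric] sum_pmf_eq_1)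
qed

text \<open>Averaging the recursion over the state law at stage \<open>h\<close> carries the mass to
  stage \<open>Suc h\<close>, which drives an induction on the number \<open>n\<close> of stages
  left. Since the kernel ignores the measure, the states follow the flow induced by
  \<open>\<pi>\<close>, whatever \<open>\<mu>\<close> is.\<close>

lemma expectation_path_pmf_induced_flow:
  fixes P :: "('s::finite, 'a::finite) mf_kernel" and g :: "nat \<Rightarrow> 's \<Rightarrow> 'a \<Rightarrow> real"
  assumes P: "\<And>s a \<nu>. P s a \<nu> = Q s a"
  shows "(\<Sum>x\<in>UNIV. pmf (induced_flow \<mu>\<^sub>0 Q \<pi> h) x *
      measure_pmf.expectation (path_pmf P \<pi> \<mu> n h x)
        (\<lambda>\<omega>. \<Sum>k<n. g (h + k) (fst (\<omega> ! k)) (snd (\<omega> ! k)))) =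
    (\<Sum>k<n. \<Sum>s\<in>UNIV. \<Sum>a\<in>UNIV.
      g (h + k) s a * occupation \<pi> (induced_flow \<mu>\<^sub>0 Q \<pi>) (h + k) s a)"
proof (induction n arbitrary: h)
  case 0
  then show ?case by simp
next
  case (Suc n)
  let ?m = "induced_flow \<mu>\<^sub>0 Q \<pi>"
  define V where "V n h x = measure_pmf.expectation (path_pmf P \<pi> \<mu> n h x)
      (\<lambda>\<omega>. \<Sum>k<n. g (h + k) (fst (\<omega> ! k)) (snd (\<omega> ! k)))" for n h x
  \<comment> \<open>Summing over the next state \<open>y\<close> last collects all mass arriving at
    \<open>y\<close>, which is the induced flow at \<open>Suc h\<close>.\<close>
  have "(\<Sum>x\<in>UNIV. \<Sum>a\<in>UNIV. \<Sum>y\<in>UNIV. pmf (Q x a) y * pmf (\<pi> h x) a * pmf (?m h) x * V n (Suc h) y)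
      = (\<Sum>y\<in>UNIV. \<Sum>x\<in>UNIV. \<Sum>a\<in>UNIV.
          pmf (Q x a) y * pmf (\<pi> h x) a * pmf (?m h) x * V n (Suc h) y)"
    by (subst (2) sum.swap) (intro sum.cong refl sum.swap)
  also have "\<dots> = (\<Sum>y\<in>UNIV. pmf (?m (Suc h)) y * V n (Suc h) y)"
    by (simp only: pmf_induced_flow_Suc sum_distrib_right)
  finally have future: "(\<Sum>x\<in>UNIV. \<Sum>a\<in>UNIV. \<Sum>y\<in>UNIV.
      pmf (Q x a) y * pmf (\<pi> h x) a * pmf (?m h) x * V n (Suc h) y) =
    (\<Sum>y\<in>UNIV. pmf (?m (Suc h)) y * V n (Suc h) y)" .
  have "(\<Sum>x\<in>UNIV. pmf (?m h) x * V (Suc n) h x) =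
      (\<Sum>x\<in>UNIV. \<Sum>a\<in>UNIV. g h x a * occupation \<pi> ?m h x a) +
      (\<Sum>x\<in>UNIV. \<Sum>a\<in>UNIV. \<Sum>y\<in>UNIV.
        pmf (Q x a) y * pmf (\<pi> h x) a * pmf (?m h) x * V n (Suc h) y)"
    unfolding V_def expectation_path_pmf_Suc P
    by (simp add: occupation_def sum.distrib[symmetric] sum_distrib_left distrib_left mult_ac
        del: sum.lessThan_Suc)
  also have "\<dots> = (\<Sum>x\<in>UNIV. \<Sum>a\<in>UNIV. g h x a * occupation \<pi> ?m h x a) +
      (\<Sum>k<n. \<Sum>s\<in>UNIV. \<Sum>a\<in>UNIV. g (Suc h + k) s a * occupation \<pi> ?m (Suc h + k) s a)"
    by (simp only: future) (simp only: V_def Suc.IH)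
  finally show ?case
    by (simp add: V_def sum.lessThan_Suc_shift del: sum.lessThan_Suc)
qed

text \<open>Here \<open>\<mu>\<close> enters only through the reward and need not be generated by
  \<open>\<pi>\<close>, so the formula covers policies that deviate from an equilibrium.\<close>

lemma objective_eq_sum_occupation:
  fixes P :: "('s::finite, 'a::finite) mf_kernel"
  assumes "\<And>s a \<nu>. P s a \<nu> = Q s a"
  shows "objective H \<mu>\<^sub>0 r P \<pi> \<mu> =
    (\<Sum>h<H. \<Sum>s\<in>UNIV. \<Sum>a\<in>UNIV. r s a (\<mu> h) * occupation \<pi> (induced_flow \<mu>\<^sub>0 Q \<pi>) h s a)"
  unfolding objective_def trajectory_pmf_def
  using expectation_path_pmf_induced_flow[OF assms,
      where h = 0 and n = H and g = "\<lambda>h s a. r s a (\<mu> h)"]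
  by (simp add: pmf_expectation_bind[where A = UNIV] finite_set_path_pmf)

lemma sum_occupation [simp]:
  fixes \<pi> :: "('s, 'a::finite) policy_flow"
  shows "(\<Sum>a\<in>UNIV. occupation \<pi> \<mu> h s a) = pmf (\<mu> h) s"
  by (simp add: occupation_def sum_distrib_right[symmetric] sum_pmf_eq_1)

text \<open>Nonnegativity and the initial marginal come for free; what remains of membership is flow
  balance, the consistency condition of an equilibrium.\<close>

lemma occupation_in_polytope_iff:
  fixes Q :: "'s::finite \<Rightarrow> 'a::finite \<Rightarrow> 's pmf"
  assumes "\<mu> 0 = \<mu>\<^sub>0"
  shows "occupation \<pi> \<mu> \<in> occupation_polytope H \<mu>\<^sub>0 Q \<longleftrightarrow>
    (\<forall>h. Suc h < H \<longrightarrow> (\<forall>s'. pmf (\<mu> (Suc h)) s' =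
      (\<Sum>s\<in>UNIV. \<Sum>a\<in>UNIV. pmf (Q s a) s' * pmf (\<pi> h s) a * pmf (\<mu> h) s)))"
proof -
  have "0 \<le> occupation \<pi> \<mu> h s a" for h s a
    by (simp add: occupation_def)
  then show ?thesis
    by (simp add: occupation_polytope_def assms) (simp add: occupation_def mult.assoc)
qed

lemma occupation_induced_flow_in_polytope:
  fixes Q :: "'s::finite \<Rightarrow> 'a::finite \<Rightarrow> 's pmf"
  shows "occupation \<pi> (induced_flow \<mu>\<^sub>0 Q \<pi>) \<in> occupation_polytope H \<mu>\<^sub>0 Q"
  by (subst occupation_in_polytope_iff) (simp_all only: pmf_induced_flow_Suc induced_flow.simps(1) simp_thms)

text \<open>Flow balance is the recursion defining the induced flow, with the same start. It
  determines \<open>\<mu>\<close> only below \<open>H\<close>.\<close>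

lemma state_flow_eq_induced_flow:
  fixes Q :: "'s::finite \<Rightarrow> 'a::finite \<Rightarrow> 's pmf"
  assumes "occupation \<pi> \<mu> \<in> occupation_polytope H \<mu>\<^sub>0 Q" and "\<mu> 0 = \<mu>\<^sub>0" and "h < H"
  shows "\<mu> h = induced_flow \<mu>\<^sub>0 Q \<pi> h"
  using assms(3)
proof (induction h)
  case 0
  then show ?case using assms(2) by simp
next
  case (Suc h)
  then have "\<mu> h = induced_flow \<mu>\<^sub>0 Q \<pi> h" and "Suc h < H"
    by simp_all
  then show ?case
    using assms(1) unfolding occupation_in_polytope_iff[of \<mu>, OF assms(2)]
    by (intro pmf_eqI) (simp only: pmf_induced_flow_Suc)
qed

lemma polytope_point_is_occupation:
  fixes Q :: "'s::finite \<Rightarrow> 'a::finite \<Rightarrow> 's pmf"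
  assumes \<rho>: "\<rho> \<in> occupation_polytope H \<mu>\<^sub>0 Q"
  obtains \<pi> where "\<And>h s a. h < H \<Longrightarrow> occupation \<pi> (induced_flow \<mu>\<^sub>0 Q \<pi>) h s a = \<rho> h s a"
proof -
  have nonneg: "0 \<le> \<rho> h s a" if "h < H" for h s a
    using \<rho> that by (simp add: occupation_polytope_def)
  let ?m = "\<lambda>h s. \<Sum>a\<in>UNIV. \<rho> h s a"
  \<comment> \<open>The product form avoids dividing by zero: at a state without mass all entries of
    \<open>\<rho>\<close> vanish and any \<open>p\<close> serves; elsewhere \<open>p\<close> is the
    conditional distribution of the action.\<close>
  have "\<exists>p. \<forall>a. pmf p a * ?m h s = \<rho> h s a" if h: "h < H" for h s
  proof (cases "?m h s = 0")
    case True
    then have "\<rho> h s a = 0" for a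
      using nonneg[OF h] by (simp add: sum_nonneg_eq_0_iff)
    with True show ?thesis by simp
  next
    case False
    have pos: "0 \<le> ?m h s"
      by (intro sum_nonneg nonneg h)
    have "(\<Sum>a\<in>UNIV. \<rho> h s a / ?m h s) = 1"
      using False by (simp add: sum_divide_distrib[symmetric])
    then have "(\<integral>\<^sup>+a. ennreal (\<rho> h s a / ?m h s) \<partial>count_space UNIV) = 1"
      using nonneg[OF h] pos by (simp add: nn_integral_count_space_finite)
    then have "pmf (embed_pmf (\<lambda>a. \<rho> h s a / ?m h s)) a = \<rho> h s a / ?m h s" for a
      using nonneg[OF h] pos by (intro pmf_embed_pmf) simp_all
    with False show ?thesis
      by (intro exI[of _ "embed_pmf (\<lambda>a. \<rho> h s a / ?m h s)"]) simp
  qed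
  then obtain \<pi> where \<pi>: "\<And>h s a. h < H \<Longrightarrow> pmf (\<pi> h s) a * ?m h s = \<rho> h s a"
    by metis
  have "occupation \<pi> (state_marginal \<rho>) h s a = \<rho> h s a" if "h < H" for h s a
    using \<pi> that by (simp add: occupation_def pmf_state_marginal[OF \<rho>])
  \<comment> \<open>So far \<open>\<pi>\<close> reproduces \<open>\<rho>\<close> over the marginals
    of \<open>\<rho>\<close> itself. These are the state laws generated by \<open>\<pi>\<close>, by
    flow balance and induction on the stage.\<close>
  moreover have "state_marginal \<rho> h = induced_flow \<mu>\<^sub>0 Q \<pi> h" if "h < H" for h
    using that
  proof (induction h)
    case 0
    then show ?case
      using \<rho> by (intro pmf_eqI) (simp add: pmf_state_marginal[OF \<rho>], simp add: occupation_polytope_def)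
  next
    case (Suc h)
    then have h: "h < H" by simp
    have "pmf (state_marginal \<rho> (Suc h)) s' = pmf (induced_flow \<mu>\<^sub>0 Q \<pi> (Suc h)) s'" for s'
    proof -
      have "pmf (state_marginal \<rho> (Suc h)) s' = (\<Sum>s\<in>UNIV. \<Sum>a\<in>UNIV. pmf (Q s a) s' * \<rho> h s a)"
        unfolding pmf_state_marginal[OF \<rho> Suc.prems]
        using \<rho> Suc.prems by (simp add: occupation_polytope_def)
      also have "\<dots> = pmf (induced_flow \<mu>\<^sub>0 Q \<pi> (Suc h)) s'"
        unfolding pmf_induced_flow_Suc Suc.IH[OF h, symmetric] pmf_state_marginal[OF \<rho> h]
        by (simp only: mult.assoc \<pi>[OF h])
      finally show ?thesis .
    qed
    then show ?case by (rule pmf_eqI)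
  qed
  ultimately show ?thesis
    by (intro that[of \<pi>]) (simp add: occupation_def)
qed

theorem theorem1:
  fixes H :: nat
    and \<mu>\<^sub>0 :: "'s::finite pmf"
    and r :: "('s, 'a::finite) reward"
    and P :: "('s, 'a) mf_kernel"
    and Q :: "'s \<Rightarrow> 'a \<Rightarrow> 's pmf"
    and L :: real
    and \<pi>' :: "('s, 'a) policy_flow"
    and \<mu>' :: "'s state_flow"
  defines "\<rho>' \<equiv> occupation \<pi>' \<mu>'"
  assumes "H \<ge> 1"
    and "weakly_monotone H \<mu>\<^sub>0 r Q"
    and "\<forall>s a \<mu>. P s a \<mu> = Q s a"
    and "lipschitz_reward r L"
    and "\<mu>' 0 = \<mu>\<^sub>0"
  shows "mean_field_equilibrium H \<mu>\<^sub>0 r P \<pi>' \<mu>' \<longleftrightarrow>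
    \<rho>' \<in> occupation_polytope H \<mu>\<^sub>0 Q \<and>
    (\<forall>\<rho>\<in>occupation_polytope H \<mu>\<^sub>0 Q.
       flow_inner H (occupation_operator r \<rho>') (\<rho> - \<rho>') \<ge> 0)"
proof -
  have P: "\<And>s a \<nu>. P s a \<nu> = Q s a"
    using assms by blast
  have \<mu>'0: "\<mu>' 0 = \<mu>\<^sub>0"
    using assms by blast
  \<comment> \<open>Consistency and membership in the polytope coincide, so optimality and the
    inequality need comparing only when \<open>\<rho>'\<close> is a member.\<close>
  have equilibrium_iff: "mean_field_equilibrium H \<mu>\<^sub>0 r P \<pi>' \<mu>' \<longleftrightarrow>
      (\<forall>\<pi>. objective H \<mu>\<^sub>0 r P \<pi> \<mu>' \<le> objective H \<mu>\<^sub>0 r P \<pi>' \<mu>') \<and>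
      \<rho>' \<in> occupation_polytope H \<mu>\<^sub>0 Q"
    unfolding mean_field_equilibrium_def \<rho>'_def occupation_in_polytope_iff[of \<mu>', OF \<mu>'0] P ..
  have "(\<forall>\<pi>. objective H \<mu>\<^sub>0 r P \<pi> \<mu>' \<le> objective H \<mu>\<^sub>0 r P \<pi>' \<mu>') \<longleftrightarrow>
      (\<forall>\<rho>\<in>occupation_polytope H \<mu>\<^sub>0 Q. flow_inner H (occupation_operator r \<rho>') (\<rho> - \<rho>') \<ge> 0)"
    if \<rho>': "\<rho>' \<in> occupation_polytope H \<mu>\<^sub>0 Q"
  proof -
    have marginal: "state_marginal \<rho>' h = \<mu>' h" if "h < H" for h
      using pmf_state_marginal[OF \<rho>' that] by (intro pmf_eqI) (simp add: \<rho>'_def)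
    have flow: "\<mu>' h = induced_flow \<mu>\<^sub>0 Q \<pi>' h" if "h < H" for h
      using \<rho>' \<mu>'0 that unfolding \<rho>'_def by (rule state_flow_eq_induced_flow)
    \<comment> \<open>The inner product is the value lost by deviating from \<open>\<pi>'\<close> to
      a policy that generates \<open>\<rho>\<close>, with the measures kept at
      \<open>\<mu>'\<close>.\<close>
    have gap: "flow_inner H (occupation_operator r \<rho>') (\<rho> - \<rho>') =
        objective H \<mu>\<^sub>0 r P \<pi>' \<mu>' - objective H \<mu>\<^sub>0 r P \<pi> \<mu>'"
      if \<pi>: "\<And>h s a. h < H \<Longrightarrow> occupation \<pi> (induced_flow \<mu>\<^sub>0 Q \<pi>) h s a = \<rho> h s a" for \<rho> \<pi>
    proof -
      have "flow_inner H (occupation_operator r \<rho>') (\<rho> - \<rho>') =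
          (\<Sum>h<H. \<Sum>s\<in>UNIV. \<Sum>a\<in>UNIV. r s a (\<mu>' h) * \<rho>' h s a - r s a (\<mu>' h) * \<rho> h s a)"
        by (simp add: flow_inner_def occupation_operator_def marginal algebra_simps)
      also have "\<dots> = (\<Sum>h<H. \<Sum>s\<in>UNIV. \<Sum>a\<in>UNIV.
          r s a (\<mu>' h) * occupation \<pi>' (induced_flow \<mu>\<^sub>0 Q \<pi>') h s a -
          r s a (\<mu>' h) * occupation \<pi> (induced_flow \<mu>\<^sub>0 Q \<pi>) h s a)"
        by (intro sum.cong refl) (simp add: \<pi>, simp add: \<rho>'_def occupation_def flow)
      finally show ?thesis
        by (simp add: objective_eq_sum_occupation[of P Q, OF P] sum_subtractf)
    qed
    show ?thesis
    proof (intro iffI ballI allI)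
      fix \<rho>
      assume opt: "\<forall>\<pi>. objective H \<mu>\<^sub>0 r P \<pi> \<mu>' \<le> objective H \<mu>\<^sub>0 r P \<pi>' \<mu>'"
        and "\<rho> \<in> occupation_polytope H \<mu>\<^sub>0 Q"
      then obtain \<pi> where "\<And>h s a. h < H \<Longrightarrow> occupation \<pi> (induced_flow \<mu>\<^sub>0 Q \<pi>) h s a = \<rho> h s a"
        using polytope_point_is_occupation by blast
      from gap[of \<pi> \<rho>, OF this] opt
      show "flow_inner H (occupation_operator r \<rho>') (\<rho> - \<rho>') \<ge> 0"
        by simp
    next
      fix \<pi>
      assume "\<forall>\<rho>\<in>occupation_polytope H \<mu>\<^sub>0 Q.
        flow_inner H (occupation_operator r \<rho>') (\<rho> - \<rho>') \<ge> 0"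
      \<comment> \<open>With \<open>refl\<close>, \<open>\<rho>\<close> is the occupation flow of
        the deviation \<open>\<pi>\<close> itself.\<close>
      with occupation_induced_flow_in_polytope gap[of \<pi>, OF refl]
      show "objective H \<mu>\<^sub>0 r P \<pi> \<mu>' \<le> objective H \<mu>\<^sub>0 r P \<pi>' \<mu>'"
        by (metis diff_ge_0_iff_ge)
    qed
  qed
  with equilibrium_iff show ?thesis
    by blast
qed

end
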